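(* Let $\mathcal{C}=\mathrm{Corridor}(u,l,D)$ be an $\mathbb{R}^m$-corridor, let $X\subset D$ be a finite set, let $H=(X,E)$ be an incompatibility hypergraph for $\mathcal{C}$, and let $G$ be the graph obtained from $H$ by dropping all edges with at least three vertices. Then the optimal values of $(\mathcal{R}^{\mathrm{MumC}})$ and $(\mathcal{R}^{\mathrm{MalC}})$, i.e. the cardinality of a maximum clique of $G$ and the cardinality of any maximal clique of $G$ respectively, are lower bounds on the optimal value of the Corridor Fitting Problem in $\mathbb{R}^m$ on $\mathcal{C}$, i.e. on the minimum number of pieces of a piecewise linear function $g$ with domain $D$ satisfying $l(x)\le g(x)\le u(x)$ for all $x\in D$.
   Context: "Linear function" means affine function $x\mapsto a^Tx+b$ with $a\in\mathbb{R}^m$, $b\in\mathbb{R}$. Polytopes are compact; $\mathrm{int}$, $\mathrm{bd}$ and $\mathrm{conv}$ denote interior, boundary and convex hull. Corridor: let $D\subset\mathbb{R}^m$ be a full-dimensional polytope and $u,l:D\to\mathbb{R}$ continuous functions with $l(x)<u(x)$ for all $x\in D$. The $\mathbb{R}^m$-corridor between $u$ and $l$ of domain $D$ is $\mathrm{Corridor}(u,l,D)=\{(x,z)\in\mathbb{R}^{m+1} : x\in D,\ l(x)\le z\le u(x)\}$ (given together with the data $u,l,D$). Piecewise linear function with $n$ pieces and domain $D$ ($n\ge 1$ an integer): given full-dimensional polytopes $D_1,\dots,D_n\subset\mathbb{R}^m$ covering $D$ with pairwise disjoint interiors, and linear functions $l_i:D_i\to\mathbb{R}$, it is the function $g$ on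 $D$ with $g(x)=l_i(x)$ if $x\in\mathrm{int}(D_i)$, and, if $x$ lies on the boundary of some $D_i$, $g(x)=\min\{l_i(x): i \text{ with } x\in D_i\}$. Corridor Fitting Problem in $\mathbb{R}^m$ ($\mathbb{R}^m$-CFP) on $\mathrm{Corridor}(u,l,D)$: find a piecewise linear function $g$ with domain $D$ with the minimum number $n$ of pieces subject to $l(x)\le g(x)\le u(x)$ for all $x\in D$. Its optimal value is this minimum number of pieces. Linearly compatible set: a finite set $s\subset D$ is linearly compatible (for $\mathrm{Corridor}(u,l,D)$) if there is a linear function $L$ with $l(x)\le L(x)\le u(x)$ for all $x\in\mathrm{conv}(s)$; otherwise it is not linearly compatible. Incompatibility hypergraph for $\mathcal{C}$: a hypergraph $H=(X,E)$ (edges are subsets of the finite vertex set $X\subset D$, possibly with more than two vertices), each of whose edges is a subset of $X$ that is not linearly compatible for $\mathcal{C}$ (not every such subset needs to be an edge). Problem $(\mathcal{R}^{\mathrm{MumC}})$: find a clique of maximum cardinality among the cliques of $G$. Problem $(\mathcal{R}^{\mathrm{MalC}})$: find a maximal clique of $G$, i.e. a clique that is not a proper subset of another clique of $G$. The value of a solution is the cardinality of the clique. *)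

theory Defs
  imports "HOL-Analysis.Analysis" "HOL-Library.Ramsey" "HOL-Library.Extended_Nat"
begin

definition full_dim_polytope :: "'a::euclidean_space set \<Rightarrow> bool" where
  "full_dim_polytope P \<longleftrightarrow> polytope P \<and> aff_dim P = int DIM('a)"

text \<open>``Linear'' means affine: \<open>x \<mapsto> a\<^sup>T x + b\<close>.\<close>

definition linear_function :: "('a::euclidean_space \<Rightarrow> real) \<Rightarrow> bool" where
  "linear_function L \<longleftrightarrow> (\<exists>a b. \<forall>x. L x = a \<bullet> x + b)"

text \<open>A corridor is represented by its data: upper bound, lower bound and domain. The values
  of \<open>u\<close> and \<open>l\<close> outside \<open>D\<close> play no role.\<close>

definition corridor ::
    "('a::euclidean_space \<Rightarrow> real) \<Rightarrow> ('a \<Rightarrow> real) \<Rightarrow> 'a set \<Rightarrow> bool" where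
  "corridor u l D \<longleftrightarrow>
     full_dim_polytope D \<and> continuous_on D u \<and> continuous_on D l \<and> (\<forall>x\<in>D. l x < u x)"

text \<open>The pieces have to cover \<open>D\<close>, but need not be contained in it. Only the values of \<open>g\<close>
  on \<open>D\<close> are constrained.\<close>

definition piecewise_linear ::
    "nat \<Rightarrow> 'a::euclidean_space set \<Rightarrow> ('a \<Rightarrow> real) \<Rightarrow> bool" where
  "piecewise_linear n D g \<longleftrightarrow> n \<ge> 1 \<and>
     (\<exists>(P :: nat \<Rightarrow> 'a set) (L :: nat \<Rightarrow> 'a \<Rightarrow> real).
        (\<forall>i<n. full_dim_polytope (P i) \<and> linear_function (L i)) \<and>
        D \<subseteq> (\<Union>i<n. P i) \<and>
        (\<forall>i<n. \<forall>j<n. i \<noteq> j \<longrightarrow> interior (P i) \<inter> interior (P j) = {}) \<and>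
        (\<forall>x\<in>D. \<forall>i<n. x \<in> interior (P i) \<longrightarrow> g x = L i x) \<and>
        (\<forall>x\<in>D. (\<exists>i<n. x \<in> frontier (P i)) \<longrightarrow> g x = Min {L i x | i. i < n \<and> x \<in> P i}))"

definition cfp_feasible ::
    "('a::euclidean_space \<Rightarrow> real) \<Rightarrow> ('a \<Rightarrow> real) \<Rightarrow> 'a set \<Rightarrow> nat \<Rightarrow> ('a \<Rightarrow> real) \<Rightarrow> bool" where
  "cfp_feasible u l D n g \<longleftrightarrow> piecewise_linear n D g \<and> (\<forall>x\<in>D. l x \<le> g x \<and> g x \<le> u x)"

text \<open>Minimum number of pieces of a feasible solution. It is taken in \<^typ>\<open>enat\<close>: the infimum of a
  nonempty set of extended naturals is its minimum, and the value is \<open>\<infinity>\<close> if nothing is feasible.\<close>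

definition cfp_value ::
    "('a::euclidean_space \<Rightarrow> real) \<Rightarrow> ('a \<Rightarrow> real) \<Rightarrow> 'a set \<Rightarrow> enat" where
  "cfp_value u l D = Inf {enat n | n. \<exists>g. cfp_feasible u l D n g}"

definition linearly_compatible ::
    "('a::euclidean_space \<Rightarrow> real) \<Rightarrow> ('a \<Rightarrow> real) \<Rightarrow> 'a set \<Rightarrow> bool" where
  "linearly_compatible u l s \<longleftrightarrow>
     (\<exists>L. linear_function L \<and> (\<forall>x \<in> convex hull s. l x \<le> L x \<and> L x \<le> u x))"

definition incompatibility_hypergraph ::
    "('a::euclidean_space \<Rightarrow> real) \<Rightarrow> ('a \<Rightarrow> real) \<Rightarrow> 'a set \<Rightarrow> 'a set \<Rightarrow> 'a set set \<Rightarrow> bool" where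
  "incompatibility_hypergraph u l D X E \<longleftrightarrow>
     finite X \<and> X \<subseteq> D \<and> (\<forall>e\<in>E. e \<subseteq> X \<and> \<not> linearly_compatible u l e)"

definition drop_large_edges :: "'a set set \<Rightarrow> 'a set set" where
  "drop_large_edges E = {e \<in> E. \<not> card e \<ge> 3}"

definition graph_clique :: "'a set \<Rightarrow> 'a set set \<Rightarrow> 'a set \<Rightarrow> bool" where
  "graph_clique X F K \<longleftrightarrow> K \<subseteq> X \<and> clique K F"

definition maximum_clique :: "'a set \<Rightarrow> 'a set set \<Rightarrow> 'a set \<Rightarrow> bool" where
  "maximum_clique X F K \<longleftrightarrow> is_arg_max card (graph_clique X F) K"

definition maximal_clique :: "'a set \<Rightarrow> 'a set set \<Rightarrow> 'a set \<Rightarrow> bool" where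
  "maximal_clique X F K \<longleftrightarrow> graph_clique X F K \<and> \<not> (\<exists>K'. graph_clique X F K' \<and> K \<subset> K')"

end

theory Submission
  imports Defs
begin

text \<open>
  The vertices of a clique are pairwise incompatible, so it suffices to map them to the pieces of
  any feasible function such that two vertices with the same image are compatible; the map is then
  injective on the clique. Sending a vertex to a piece that contains it is not enough: at
  boundary points \<open>g\<close> is a minimum over several pieces, so the affine map attached to one of them
  is not directly bounded there. Moreover a piece may lie outside \<open>D\<close> and touch it only
  at the boundary, and then its affine map is not constrained by the corridor at all.

  Both difficulties disappear when only the pieces \<open>P\<close> that meet the interior of \<open>D\<close> are used.
  For them \<open>P \<inter> D\<close> is convex with nonempty interior, hence it is the closure of
  \<open>interior P \<inter> interior D\<close>. The affine map agrees with \<open>g\<close> on that open set and stays inside the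
  corridor there, and by continuity it does so on all of \<open>P \<inter> D\<close>
  (\<open>affine_piece_in_corridor\<close>). These pieces still cover \<open>D\<close>: they cover its interior, their union
  is closed, and \<open>D\<close> is the closure of its interior (\<open>cover_by_pieces_meeting_interior\<close>).
\<close>

lemma full_dim_polytope_imp_convex: "full_dim_polytope P \<Longrightarrow> convex P"
  by (simp add: full_dim_polytope_def polytope_imp_convex)

lemma full_dim_polytope_imp_closed: "full_dim_polytope P \<Longrightarrow> closed P"
  by (simp add: full_dim_polytope_def polytope_imp_closed)

lemma interior_full_dim_polytope_nonempty:
  fixes P :: "'a::euclidean_space set"
  assumes "full_dim_polytope P"
  shows "interior P \<noteq> {}"
proof -
  have dim: "aff_dim P = int DIM('a)"
    using assms by (simp add: full_dim_polytope_def)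
  then have "P \<noteq> {}"
    by auto
  moreover have "rel_interior P = interior P"
    using dim rel_interior_interior[of P] aff_dim_eq_full[of P] by blast
  ultimately show ?thesis
    using rel_interior_eq_empty[OF full_dim_polytope_imp_convex[OF assms]] by simp
qed

lemma closure_interior_full_dim_polytope:
  assumes "full_dim_polytope P"
  shows "closure (interior P) = P"
  using convex_closure_interior[OF full_dim_polytope_imp_convex[OF assms]
      interior_full_dim_polytope_nonempty[OF assms]]
    full_dim_polytope_imp_closed[OF assms] by simp

lemma linear_function_continuous_on: "linear_function L \<Longrightarrow> continuous_on S L"
proof -
  assume "linear_function L"
  then obtain a b where "L = (\<lambda>x. a \<bullet> x + b)"
    unfolding linear_function_def by blast
  then show ?thesis
    by (auto intro!: continuous_intros)
qed

text \<open>A piece whose interior misses the interior of \<open>D\<close> misses the latter entirely, since it is the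
  closure of its own interior. So the other pieces, whose union is closed, cover the interior of
  \<open>D\<close> and with it the closure of this interior.\<close>

lemma cover_by_pieces_meeting_interior:
  fixes D :: "'a::euclidean_space set"
  assumes D: "full_dim_polytope D"
    and "finite I"
    and P: "\<And>i. i \<in> I \<Longrightarrow> full_dim_polytope (P i)"
    and cover: "D \<subseteq> (\<Union>i\<in>I. P i)"
  shows "D \<subseteq> (\<Union>i\<in>{i\<in>I. interior (P i) \<inter> interior D \<noteq> {}}. P i)"
    (is "D \<subseteq> ?U")
proof -
  have "interior D \<subseteq> ?U"
  proof
    fix x assume x: "x \<in> interior D"
    then obtain i where i: "i \<in> I" "x \<in> P i"
      using cover interior_subset by blast
    then have "x \<in> closure (interior (P i))"
      using closure_interior_full_dim_polytope[OF P] by simp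
    then have "interior (P i) \<inter> interior D \<noteq> {}"
      using x open_Int_closure_eq_empty[OF open_interior, of D "interior (P i)"] by blast
    with i show "x \<in> ?U"
      by blast
  qed
  moreover have "closed ?U"
    using \<open>finite I\<close> P full_dim_polytope_imp_closed by (intro closed_UN) auto
  ultimately have "closure (interior D) \<subseteq> ?U"
    by (rule closure_minimal)
  then show ?thesis
    by (simp add: closure_interior_full_dim_polytope[OF D])
qed

text \<open>The bounds are known where \<open>L\<close> agrees with the fitted function, namely on the interior of
  the piece; they pass to the closure because \<open>u - L\<close> and \<open>L - l\<close> are continuous.\<close>

lemma affine_piece_in_corridor:
  fixes D :: "'a::euclidean_space set"
  assumes cor: "corridor u l D"
    and P: "full_dim_polytope P" and L: "linear_function L"
    and meet: "interior P \<inter> interior D \<noteq> {}"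
    and bounds: "\<And>x. x \<in> D \<Longrightarrow> x \<in> interior P \<Longrightarrow> l x \<le> L x \<and> L x \<le> u x"
    and x: "x \<in> P \<inter> D"
  shows "l x \<le> L x \<and> L x \<le> u x"
proof -
  have D: "full_dim_polytope D" and contu: "continuous_on D u" and contl: "continuous_on D l"
    using cor by (auto simp: corridor_def)
  let ?T = "interior P \<inter> interior D"
  have "closure (interior (P \<inter> D)) = closure (P \<inter> D)"
    using P D meet
    by (intro convex_closure_interior convex_Int full_dim_polytope_imp_convex) auto
  then have cl: "closure ?T = P \<inter> D"
    using P D by (simp add: closed_Int full_dim_polytope_imp_closed)
  have T: "l y \<le> L y \<and> L y \<le> u y" if "y \<in> ?T" for y
    using bounds that interior_subset by blast
  have cont: "continuous_on (closure ?T) (\<lambda>y. u y - L y)" "continuous_on (closure ?T) (\<lambda>y. L y - l y)"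
    unfolding cl
    by (intro continuous_on_diff linear_function_continuous_on L
        continuous_on_subset[OF contu] continuous_on_subset[OF contl]; simp)+
  have clx: "x \<in> closure ?T"
    using x cl by simp
  have "u x - L x \<ge> 0"
    by (rule continuous_ge_on_closure[OF cont(1) clx]) (use T in simp)
  moreover have "L x - l x \<ge> 0"
    by (rule continuous_ge_on_closure[OF cont(2) clx]) (use T in simp)
  ultimately show ?thesis
    by simp
qed

lemma linearly_compatible_if_in_piece:
  fixes D :: "'a::euclidean_space set"
  assumes "corridor u l D" "full_dim_polytope P" "linear_function L"
    "interior P \<inter> interior D \<noteq> {}"
    and "\<And>x. x \<in> D \<Longrightarrow> x \<in> interior P \<Longrightarrow> l x \<le> L x \<and> L x \<le> u x"
    and "s \<subseteq> P \<inter> D"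
  shows "linearly_compatible u l s"
proof -
  have "convex (P \<inter> D)"
    using assms(1,2) by (simp add: corridor_def convex_Int full_dim_polytope_imp_convex)
  then have "convex hull s \<subseteq> P \<inter> D"
    using \<open>s \<subseteq> P \<inter> D\<close> by (rule hull_minimal[rotated])
  then show ?thesis
    unfolding linearly_compatible_def
    using affine_piece_in_corridor[OF assms(1-5)] \<open>linear_function L\<close> by blast
qed

text \<open>The pieces of a feasible function colour the points of \<open>D\<close> so that every monochromatic set
  is compatible. Thus feasible functions with \<open>n\<close> pieces yield weak \<open>n\<close>-colourings of every
  incompatibility hypergraph.\<close>

lemma cfp_feasible_imp_colouring:
  fixes D :: "'a::euclidean_space set"
  assumes cor: "corridor u l D" and feas: "cfp_feasible u l D n g"
  obtains c :: "'a \<Rightarrow> nat"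
  where "c ` D \<subseteq> {..<n}"
    and "\<And>s i. s \<subseteq> D \<Longrightarrow> c ` s \<subseteq> {i} \<Longrightarrow> i < n \<Longrightarrow> linearly_compatible u l s"
proof -
  from feas have bounds: "l x \<le> g x \<and> g x \<le> u x" if "x \<in> D" for x
    using that by (simp add: cfp_feasible_def)
  from feas have "piecewise_linear n D g"
    by (simp add: cfp_feasible_def)
  then obtain P L where
    pieces: "\<forall>i<n. full_dim_polytope (P i) \<and> linear_function (L i)"
    and cover: "D \<subseteq> (\<Union>i<n. P i)"
    and g: "\<forall>x\<in>D. \<forall>i<n. x \<in> interior (P i) \<longrightarrow> g x = L i x"
    unfolding piecewise_linear_def by (elim conjE exE) (rule that)
  define J where "J = {i\<in>{..<n}. interior (P i) \<inter> interior D \<noteq> {}}"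
  have "D \<subseteq> (\<Union>i\<in>J. P i)"
    unfolding J_def using cor pieces cover
    by (intro cover_by_pieces_meeting_interior) (auto simp: corridor_def)
  then have "\<forall>x\<in>D. \<exists>i. i \<in> J \<and> x \<in> P i"
    by blast
  then obtain c where c: "\<And>x. x \<in> D \<Longrightarrow> c x \<in> J \<and> x \<in> P (c x)"
    by metis
  show thesis
  proof
    show "c ` D \<subseteq> {..<n}"
      using c by (auto simp: J_def)
    fix s i assume s: "s \<subseteq> D" "c ` s \<subseteq> {i}" "i < n"
    show "linearly_compatible u l s"
    proof (cases "s = {}")
      case True
      \<comment> \<open>No condition is imposed on an empty hull, so any affine map is a witness.\<close>
      have "linear_function (\<lambda>x::'a. 0)"
        unfolding linear_function_def by (rule exI[of _ 0], rule exI[of _ 0]) simp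
      with True show ?thesis
        by (auto simp: linearly_compatible_def)
    next
      case False
      then have "i \<in> J"
        using s c by blast
      have "l x \<le> L i x \<and> L i x \<le> u x" if "x \<in> D" "x \<in> interior (P i)" for x
        using g bounds[OF that(1)] \<open>i < n\<close> that by simp
      moreover have "s \<subseteq> P i \<inter> D"
        using s c by blast
      ultimately show ?thesis
        using linearly_compatible_if_in_piece[OF cor, of "P i" "L i" s] pieces \<open>i \<in> J\<close>
        by (simp add: J_def)
    qed
  qed
qed

lemma card_clique_le_pieces:
  fixes D :: "'a::euclidean_space set"
  assumes cor: "corridor u l D" and feas: "cfp_feasible u l D n g"
    and hyp: "incompatibility_hypergraph u l D X E"
    and K: "graph_clique X (drop_large_edges E) K"
  shows "card K \<le> n"
proof -
  obtain c :: "'a \<Rightarrow> nat" where c: "c ` D \<subseteq> {..<n}"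
    and comp: "\<And>s i. s \<subseteq> D \<Longrightarrow> c ` s \<subseteq> {i} \<Longrightarrow> i < n \<Longrightarrow> linearly_compatible u l s"
    using cfp_feasible_imp_colouring[OF cor feas] by blast
  have KD: "K \<subseteq> D"
    using K hyp by (auto simp: graph_clique_def incompatibility_hypergraph_def)
  have "inj_on c K"
  proof (rule inj_onI, rule ccontr)
    fix x y assume xy: "x \<in> K" "y \<in> K" "c x = c y" "x \<noteq> y"
    then have "{x, y} \<in> E"
      using K by (auto simp: graph_clique_def clique_def drop_large_edges_def)
    then have "\<not> linearly_compatible u l {x, y}"
      using hyp by (auto simp: incompatibility_hypergraph_def)
    moreover have "linearly_compatible u l {x, y}"
      using xy KD c by (intro comp[of _ "c x"]) auto
    ultimately show False
      by contradiction
  qed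
  moreover have "c ` K \<subseteq> {..<n}"
    using c KD by blast
  ultimately show ?thesis
    using card_inj_on_le[of c K "{..<n}"] by simp
qed

lemma card_clique_le_cfp_value:
  fixes D :: "'a::euclidean_space set"
  assumes "corridor u l D" "incompatibility_hypergraph u l D X E"
    "graph_clique X (drop_large_edges E) K"
  shows "enat (card K) \<le> cfp_value u l D"
  unfolding cfp_value_def
proof (rule Inf_greatest)
  fix k assume "k \<in> {enat n |n. \<exists>g. cfp_feasible u l D n g}"
  then obtain n g where "k = enat n" "cfp_feasible u l D n g"
    by blast
  then show "enat (card K) \<le> k"
    using card_clique_le_pieces[OF assms(1) _ assms(2,3)] by simp
qed

theorem proposition16:
  fixes u l :: "real ^ 'm \<Rightarrow> real"
    and D X :: "(real ^ 'm) set"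
    and E G :: "(real ^ 'm) set set"
  assumes "corridor u l D"
    and "finite X" and "X \<subseteq> D"
    and "incompatibility_hypergraph u l D X E"
    and "G = drop_large_edges E"
  shows "(\<forall>K. maximum_clique X G K \<longrightarrow> enat (card K) \<le> cfp_value u l D) \<and>
         (\<forall>K. maximal_clique X G K \<longrightarrow> enat (card K) \<le> cfp_value u l D)"
  using card_clique_le_cfp_value[OF assms(1,4)] assms(5)
  by (simp add: maximum_clique_def maximal_clique_def is_arg_max_def)

end
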